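(* Let $S$ be an integral domain and let $G$ be a finite group of ring automorphisms of $S$. Then $\mathrm{rank}_{S^G}(S_G)=1$.
   Context: $S^G$ is the subring of $G$-fixed elements. The $G$-cofixed space is $S_G=S/N$, where $N$ is the additive span (equivalently, the $S^G$-submodule generated by) all elements $g(s)-s$, $g\in G$, $s\in S$; it is an $S^G$-module. For a module $M$ over an integral domain $R$ with fraction field $K=\mathrm{Frac}(R)$, $\mathrm{rank}_R(M)=\dim_K(K\otimes_R M)$ (equivalently, the maximum size of an $R$-linearly independent subset of $M$). *)

theory Defs
  imports
    "HOL-Algebra.Bij"
    "HOL-Algebra.QuotRing"
    "HOL-Algebra.Free_Abelian_Groups"
    "HOL-Library.Extended_Nat"
    "Jordan_Normal_Form.Missing_VectorSpace"
begin

section \<open>Fixed subring and cofixed module\<close>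

definition fixed_subring :: "('a, 'm) ring_scheme \<Rightarrow> ('a \<Rightarrow> 'a) set \<Rightarrow> ('a, 'm) ring_scheme"
  where "fixed_subring S G = S\<lparr>carrier := {s \<in> carrier S. \<forall>g\<in>G. g s = s}\<rparr>"

definition cofixed_kernel :: "('a, 'm) ring_scheme \<Rightarrow> ('a \<Rightarrow> 'a) set \<Rightarrow> 'a set"
  where "cofixed_kernel S G =
    generate (add_monoid S) {g s \<ominus>\<^bsub>S\<^esub> s | g s. g \<in> G \<and> s \<in> carrier S}"

text \<open>The record type of modules extends that of rings; its fields \<open>mult\<close> and \<open>one\<close> are not
  used by the locale \<^locale>\<open>module\<close>, and are left unspecified here and below.\<close>

definition cofixed_module :: "('a, 'm) ring_scheme \<Rightarrow> ('a \<Rightarrow> 'a) set \<Rightarrow> ('a, 'a set) module"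
  where "cofixed_module S G =
    \<lparr>carrier = a_rcosets\<^bsub>S\<^esub> (cofixed_kernel S G), mult = undefined, one = undefined,
     ring.zero = cofixed_kernel S G, add = set_add S,
     smult = \<lambda>r U. \<Union>x\<in>U. cofixed_kernel S G +>\<^bsub>S\<^esub> (r \<otimes>\<^bsub>S\<^esub> x)\<rparr>"

section \<open>Field of fractions of an integral domain\<close>

definition frac_rel :: "('a, 'm) ring_scheme \<Rightarrow> (('a \<times> 'a) \<times> ('a \<times> 'a)) set"
  where "frac_rel R = {((a, b), (c, d)). a \<in> carrier R \<and> b \<in> carrier R - {\<zero>\<^bsub>R\<^esub>} \<and>
    c \<in> carrier R \<and> d \<in> carrier R - {\<zero>\<^bsub>R\<^esub>} \<and> a \<otimes>\<^bsub>R\<^esub> d = c \<otimes>\<^bsub>R\<^esub> b}"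

definition fraction :: "('a, 'm) ring_scheme \<Rightarrow> 'a \<Rightarrow> 'a \<Rightarrow> ('a \<times> 'a) set"
  where "fraction R a b = frac_rel R `` {(a, b)}"

definition frac_field :: "('a, 'm) ring_scheme \<Rightarrow> ('a \<times> 'a) set ring"
  where "frac_field R =
    \<lparr>carrier = (carrier R \<times> (carrier R - {\<zero>\<^bsub>R\<^esub>})) // frac_rel R,
     mult = \<lambda>U V. \<Union>(a, b)\<in>U. \<Union>(c, d)\<in>V. fraction R (a \<otimes>\<^bsub>R\<^esub> c) (b \<otimes>\<^bsub>R\<^esub> d),
     one = fraction R \<one>\<^bsub>R\<^esub> \<one>\<^bsub>R\<^esub>, ring.zero = fraction R \<zero>\<^bsub>R\<^esub> \<one>\<^bsub>R\<^esub>,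
     add = \<lambda>U V. \<Union>(a, b)\<in>U. \<Union>(c, d)\<in>V.
       fraction R (a \<otimes>\<^bsub>R\<^esub> d \<oplus>\<^bsub>R\<^esub> c \<otimes>\<^bsub>R\<^esub> b) (b \<otimes>\<^bsub>R\<^esub> d)\<rparr>"

section \<open>Extension of scalars\<close>

text \<open>For a ring homomorphism \<open>\<phi>\<close> from \<open>R\<close> to \<open>A\<close> and an \<open>R\<close>-module \<open>M\<close>, the \<open>A\<close>-module
  \<open>A \<otimes>\<^sub>R M\<close>: the free abelian group on \<open>A \<times> M\<close> modulo the relations of an \<open>R\<close>-balanced
  biadditive map.\<close>

definition tensor_relations :: "('r, 'm) ring_scheme \<Rightarrow> ('a, 'n) ring_scheme \<Rightarrow> ('r \<Rightarrow> 'a) \<Rightarrow>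
    ('r, 'b, 'k) module_scheme \<Rightarrow> ('a \<times> 'b \<Rightarrow>\<^sub>0 int) set"
  where "tensor_relations R A \<phi> M =
    {frag_of (a \<oplus>\<^bsub>A\<^esub> a', m) - frag_of (a, m) - frag_of (a', m) | a a' m.
       a \<in> carrier A \<and> a' \<in> carrier A \<and> m \<in> carrier M} \<union>
    {frag_of (a, m \<oplus>\<^bsub>M\<^esub> m') - frag_of (a, m) - frag_of (a, m') | a m m'.
       a \<in> carrier A \<and> m \<in> carrier M \<and> m' \<in> carrier M} \<union>
    {frag_of (a \<otimes>\<^bsub>A\<^esub> \<phi> r, m) - frag_of (a, r \<odot>\<^bsub>M\<^esub> m) | a r m.
       a \<in> carrier A \<and> r \<in> carrier R \<and> m \<in> carrier M}"

definition tensor_kernel :: "('r, 'm) ring_scheme \<Rightarrow> ('a, 'n) ring_scheme \<Rightarrow> ('r \<Rightarrow> 'a) \<Rightarrow>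
    ('r, 'b, 'k) module_scheme \<Rightarrow> ('a \<times> 'b \<Rightarrow>\<^sub>0 int) set"
  where "tensor_kernel R A \<phi> M =
    generate (free_Abelian_group (carrier A \<times> carrier M)) (tensor_relations R A \<phi> M)"

text \<open>Scalars act on pure tensors by \<open>a (b \<otimes> m) = ab \<otimes> m\<close>.\<close>

definition scalar_extension :: "('r, 'm) ring_scheme \<Rightarrow> ('a, 'n) ring_scheme \<Rightarrow> ('r \<Rightarrow> 'a) \<Rightarrow>
    ('r, 'b, 'k) module_scheme \<Rightarrow> ('a, ('a \<times> 'b \<Rightarrow>\<^sub>0 int) set) module"
  where "scalar_extension R A \<phi> M =
    (let F = free_Abelian_group (carrier A \<times> carrier M); N = tensor_kernel R A \<phi> M in
    \<lparr>carrier = rcosets\<^bsub>F\<^esub> N, mult = undefined, one = undefined,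
     ring.zero = N, add = set_mult F,
     smult = \<lambda>a U. \<Union>x\<in>U. N #>\<^bsub>F\<^esub> frag_extend (\<lambda>(b, m). frag_of (a \<otimes>\<^bsub>A\<^esub> b, m)) x\<rparr>)"

section \<open>Rank of a module over an integral domain\<close>

text \<open>\<^const>\<open>vectorspace.dim\<close> is unspecified in the absence of a finite generating set, hence the
  case distinction.\<close>

definition module_rank :: "('a, 'm) ring_scheme \<Rightarrow> ('a, 'b, 'k) module_scheme \<Rightarrow> enat"
  where "module_rank R M =
    (let K = frac_field R; V = scalar_extension R K (\<lambda>r. fraction R r \<one>\<^bsub>R\<^esub>) M in
     if vectorspace.fin_dim K V then enat (vectorspace.dim K V) else \<infinity>)"

end

theory Submission
  imports Defs "HOL-Algebra.Subrings"
begin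

text \<open>Let \<open>tr s = \<Sum> g s\<close> be the trace from \<open>S\<close> to \<open>R = S\<^sup>G\<close>. It kills \<open>N\<close>, so it descends to an \<open>R\<close>-linear form on
  \<open>S\<^sub>G\<close>, and by Dedekind's independence of characters some \<open>x\<close> has \<open>c = tr x \<noteq> 0\<close>. For every \<open>s\<close>,
  \<open>c s = \<Sum> g(x) s \<equiv> \<Sum> x g\<^sup>-\<^sup>1(s) = tr(s) x\<close> modulo \<open>N\<close>. So over the fraction field the class of \<open>x\<close>
  spans \<open>S\<^sub>G\<close>, and it is nonzero there because the trace is nonzero on it.\<close>

section \<open>The field of fractions\<close>

text \<open>The element 1 need not serve as \<open>x\<close>: its trace is the order of
  \<open>G\<close> read in \<open>S\<close>, which is zero when the characteristic divides that
  order. Independence of characters produces an element of nonzero trace in every characteristic.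
  The trace form on the cofixed module need not be injective: for the Gaussian integers with
  conjugation, the class of i is a nonzero element of its kernel. The congruence shows that this
  kernel is torsion, since tr s = 0 puts c s into N; inverting c removes it. The congruence itself
  has no denominators and lives in the cofixed module. Denominators enter only with the tensor
  product, which is given by explicit cosets of a free abelian group. There, spanning is a
  computation with relations, whereas nonvanishing needs a homomorphism on the free group that kills
  all relations and not the given element.\<close>

lemma (in domain) frac_rel_equiv: "equiv (carrier R \<times> (carrier R - {\<zero>})) (frac_rel R)"
proof (rule equivI)
  show "frac_rel R \<subseteq> (carrier R \<times> (carrier R - {\<zero>})) \<times> (carrier R \<times> (carrier R - {\<zero>}))"
    by (auto simp: frac_rel_def)
  show "refl_on (carrier R \<times> (carrier R - {\<zero>})) (frac_rel R)"
    by (auto simp: frac_rel_def refl_on_def)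
  show "sym (frac_rel R)"
    by (auto simp: frac_rel_def sym_def)
  show "trans (frac_rel R)"
  proof (rule transI)
    fix p q r assume pq: "(p, q) \<in> frac_rel R" and qr: "(q, r) \<in> frac_rel R"
    obtain a b c d e f where p: "p = (a, b)" "q = (c, d)" "r = (e, f)"
      by (metis surj_pair)
    have car: "a \<in> carrier R" "b \<in> carrier R" "c \<in> carrier R" "d \<in> carrier R" "e \<in> carrier R"
      "f \<in> carrier R" and nz: "b \<noteq> \<zero>" "d \<noteq> \<zero>" "f \<noteq> \<zero>"
      and eqs: "a \<otimes> d = c \<otimes> b" "c \<otimes> f = e \<otimes> d"
      using pq qr by (auto simp: p frac_rel_def)
    \<comment> \<open>The middle denominator \<open>d\<close> is multiplied in and later cancelled,
      which is where the absence of zero divisors enters.\<close>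
    have "d \<otimes> (a \<otimes> f) = (a \<otimes> d) \<otimes> f" using car by (simp add: m_ac)
    also have "\<dots> = (c \<otimes> f) \<otimes> b" using car eqs(1) by (simp add: m_ac)
    also have "\<dots> = d \<otimes> (e \<otimes> b)" using car eqs(2) by (simp add: m_ac)
    finally have "a \<otimes> f = e \<otimes> b" using car nz by (simp add: m_lcancel)
    then show "(p, r) \<in> frac_rel R" using car nz by (simp add: p frac_rel_def)
  qed
qed

lemma (in domain) fraction_eq_iff:
  assumes "a \<in> carrier R" "b \<in> carrier R" "b \<noteq> \<zero>" "c \<in> carrier R" "d \<in> carrier R" "d \<noteq> \<zero>"
  shows "fraction R a b = fraction R c d \<longleftrightarrow> a \<otimes> d = c \<otimes> b"
  using eq_equiv_class_iff[OF frac_rel_equiv, of "(a, b)" "(c, d)"] assms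
  by (simp add: fraction_def frac_rel_def)

lemma (in domain) mem_fraction_iff:
  assumes "a \<in> carrier R" "b \<in> carrier R" "b \<noteq> \<zero>"
  shows "(c, d) \<in> fraction R a b \<longleftrightarrow>
    c \<in> carrier R \<and> d \<in> carrier R \<and> d \<noteq> \<zero> \<and> a \<otimes> d = c \<otimes> b"
  using assms by (auto simp: fraction_def frac_rel_def)

lemma (in domain) fraction_in_frac_field:
  assumes "a \<in> carrier R" "b \<in> carrier R" "b \<noteq> \<zero>"
  shows "fraction R a b \<in> carrier (frac_field R)"
  using assms by (auto simp: frac_field_def fraction_def intro: quotientI)

lemma (in domain) frac_fieldE:
  assumes "u \<in> carrier (frac_field R)"
  obtains a b where "a \<in> carrier R" "b \<in> carrier R" "b \<noteq> \<zero>" "u = fraction R a b"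
  using assms by (auto simp: frac_field_def fraction_def elim!: quotientE)

text \<open>\<open>frac_field\<close> forms sums and products as unions over all representatives.
  Once the result does not depend on these, the union collapses to a single class; nonemptiness
  excludes the empty union.\<close>

lemma UN_pairs_const:
  assumes "A \<noteq> {}" "B \<noteq> {}"
    and eq: "\<And>a b c d. (a, b) \<in> A \<Longrightarrow> (c, d) \<in> B \<Longrightarrow> f a b c d = X"
  shows "(\<Union>(a, b)\<in>A. \<Union>(c, d)\<in>B. f a b c d) = X"
proof -
  have inner: "(case q of (c, d) \<Rightarrow> f a b c d) = X" if "(a, b) \<in> A" "q \<in> B" for a b q
    using that eq by (cases q) simp
  have "(\<Union>(c, d)\<in>B. f a b c d) = X" if "(a, b) \<in> A" for a b
    by (rule SUP_eq_const[OF assms(2) inner[OF that]])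
  then have "(case p of (a, b) \<Rightarrow> \<Union>(c, d)\<in>B. f a b c d) = X" if "p \<in> A" for p
    using that by (cases p) simp
  then show ?thesis
    by (rule SUP_eq_const[OF assms(1)])
qed

lemma (in domain) mult_fraction:
  assumes "a \<in> carrier R" "b \<in> carrier R" "b \<noteq> \<zero>" "c \<in> carrier R" "d \<in> carrier R" "d \<noteq> \<zero>"
  shows "fraction R a b \<otimes>\<^bsub>frac_field R\<^esub> fraction R c d = fraction R (a \<otimes> c) (b \<otimes> d)"
proof -
  have eq: "fraction R (a' \<otimes> c') (b' \<otimes> d') = fraction R (a \<otimes> c) (b \<otimes> d)"
    if "(a', b') \<in> fraction R a b" "(c', d') \<in> fraction R c d" for a' b' c' d'
  proof -
    have car: "a' \<in> carrier R" "b' \<in> carrier R" "b' \<noteq> \<zero>" "c' \<in> carrier R" "d' \<in> carrier R" "d' \<noteq> \<zero>"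
      and eqs: "a \<otimes> b' = a' \<otimes> b" "c \<otimes> d' = c' \<otimes> d"
      using that assms by (simp_all add: mem_fraction_iff)
    have "(a' \<otimes> c') \<otimes> (b \<otimes> d) = (a' \<otimes> b) \<otimes> (c' \<otimes> d)" using car assms by (simp add: m_ac)
    also have "\<dots> = (a \<otimes> b') \<otimes> (c \<otimes> d')" by (simp add: eqs)
    also have "\<dots> = (a \<otimes> c) \<otimes> (b' \<otimes> d')" using car assms by (simp add: m_ac)
    finally show ?thesis using car assms by (simp add: fraction_eq_iff integral_iff)
  qed
  have "(a, b) \<in> fraction R a b" "(c, d) \<in> fraction R c d"
    using assms by (simp_all add: mem_fraction_iff)
  then have "fraction R a b \<noteq> {}" "fraction R c d \<noteq> {}"
    by blast+
  from UN_pairs_const[OF this eq] show ?thesis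
    by (simp add: frac_field_def)
qed

lemma (in domain) add_fraction:
  assumes "a \<in> carrier R" "b \<in> carrier R" "b \<noteq> \<zero>" "c \<in> carrier R" "d \<in> carrier R" "d \<noteq> \<zero>"
  shows "fraction R a b \<oplus>\<^bsub>frac_field R\<^esub> fraction R c d =
    fraction R (a \<otimes> d \<oplus> c \<otimes> b) (b \<otimes> d)"
proof -
  have eq: "fraction R (a' \<otimes> d' \<oplus> c' \<otimes> b') (b' \<otimes> d') = fraction R (a \<otimes> d \<oplus> c \<otimes> b) (b \<otimes> d)"
    if "(a', b') \<in> fraction R a b" "(c', d') \<in> fraction R c d" for a' b' c' d'
  proof -
    have car: "a' \<in> carrier R" "b' \<in> carrier R" "b' \<noteq> \<zero>" "c' \<in> carrier R" "d' \<in> carrier R" "d' \<noteq> \<zero>"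
      and eqs: "a \<otimes> b' = a' \<otimes> b" "c \<otimes> d' = c' \<otimes> d"
      using that assms by (simp_all add: mem_fraction_iff)
    \<comment> \<open>Each summand is grouped to expose \<open>a' \<otimes> b\<close> or
      \<open>c' \<otimes> d\<close>, which \<open>eqs\<close> exchanges for the other
      representatives.\<close>
    have "(a' \<otimes> d' \<oplus> c' \<otimes> b') \<otimes> (b \<otimes> d) = (a' \<otimes> b) \<otimes> (d' \<otimes> d) \<oplus> (c' \<otimes> d) \<otimes> (b' \<otimes> b)"
      using car assms by (simp add: l_distr r_distr m_ac)
    also have "\<dots> = (a \<otimes> b') \<otimes> (d' \<otimes> d) \<oplus> (c \<otimes> d') \<otimes> (b' \<otimes> b)" by (simp add: eqs)
    also have "\<dots> = (a \<otimes> d \<oplus> c \<otimes> b) \<otimes> (b' \<otimes> d')" using car assms by (simp add: l_distr r_distr m_ac)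
    finally show ?thesis using car assms by (simp add: fraction_eq_iff integral_iff)
  qed
  have "(a, b) \<in> fraction R a b" "(c, d) \<in> fraction R c d"
    using assms by (simp_all add: mem_fraction_iff)
  then have "fraction R a b \<noteq> {}" "fraction R c d \<noteq> {}"
    by blast+
  from UN_pairs_const[OF this eq] show ?thesis
    by (simp add: frac_field_def)
qed

lemma (in domain) zero_frac_field: "\<zero>\<^bsub>frac_field R\<^esub> = fraction R \<zero> \<one>"
  and one_frac_field: "\<one>\<^bsub>frac_field R\<^esub> = fraction R \<one> \<one>"
  by (simp_all add: frac_field_def)

lemma (in domain) field_frac_field: "field (frac_field R)"
proof -
  \<comment> \<open>On representatives, these rules turn every field axiom into a cross-multiplied
    identity in \<open>R\<close>; \<open>integral_iff\<close> keeps the denominators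
    nonzero.\<close>
  note ops = mult_fraction add_fraction zero_frac_field one_frac_field fraction_in_frac_field
    fraction_eq_iff integral_iff
  have "cring (frac_field R)"
  proof (intro cringI abelian_groupI comm_monoidI)
    fix u assume u: "u \<in> carrier (frac_field R)"
    then obtain a b where ab: "a \<in> carrier R" "b \<in> carrier R" "b \<noteq> \<zero>" "u = fraction R a b"
      by (rule frac_fieldE)
    show "\<zero>\<^bsub>frac_field R\<^esub> \<oplus>\<^bsub>frac_field R\<^esub> u = u" "\<one>\<^bsub>frac_field R\<^esub> \<otimes>\<^bsub>frac_field R\<^esub> u = u"
      using ab by (simp_all add: ops)
    have "fraction R (\<ominus> a) b \<oplus>\<^bsub>frac_field R\<^esub> u = \<zero>\<^bsub>frac_field R\<^esub>"
      using ab by (simp add: ops l_minus l_neg)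
    then show "\<exists>v\<in>carrier (frac_field R). v \<oplus>\<^bsub>frac_field R\<^esub> u = \<zero>\<^bsub>frac_field R\<^esub>"
      using ab by (meson fraction_in_frac_field a_inv_closed)
    fix v assume v: "v \<in> carrier (frac_field R)"
    then obtain c d where cd: "c \<in> carrier R" "d \<in> carrier R" "d \<noteq> \<zero>" "v = fraction R c d"
      by (rule frac_fieldE)
    show "u \<oplus>\<^bsub>frac_field R\<^esub> v \<in> carrier (frac_field R)" "u \<otimes>\<^bsub>frac_field R\<^esub> v \<in> carrier (frac_field R)"
      "u \<oplus>\<^bsub>frac_field R\<^esub> v = v \<oplus>\<^bsub>frac_field R\<^esub> u" "u \<otimes>\<^bsub>frac_field R\<^esub> v = v \<otimes>\<^bsub>frac_field R\<^esub> u"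
      using ab cd by (simp_all add: ops m_ac a_ac)
    fix w assume w: "w \<in> carrier (frac_field R)"
    then obtain e f where ef: "e \<in> carrier R" "f \<in> carrier R" "f \<noteq> \<zero>" "w = fraction R e f"
      by (rule frac_fieldE)
    show "u \<oplus>\<^bsub>frac_field R\<^esub> v \<oplus>\<^bsub>frac_field R\<^esub> w = u \<oplus>\<^bsub>frac_field R\<^esub> (v \<oplus>\<^bsub>frac_field R\<^esub> w)"
      "u \<otimes>\<^bsub>frac_field R\<^esub> v \<otimes>\<^bsub>frac_field R\<^esub> w = u \<otimes>\<^bsub>frac_field R\<^esub> (v \<otimes>\<^bsub>frac_field R\<^esub> w)"
      "(u \<oplus>\<^bsub>frac_field R\<^esub> v) \<otimes>\<^bsub>frac_field R\<^esub> w =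
        u \<otimes>\<^bsub>frac_field R\<^esub> w \<oplus>\<^bsub>frac_field R\<^esub> v \<otimes>\<^bsub>frac_field R\<^esub> w"
      using ab cd ef by (simp_all add: ops l_distr r_distr m_ac) (simp add: a_ac)
  qed (simp_all add: ops)
  then show ?thesis
  proof (rule cring.cring_fieldI2)
    show "\<zero>\<^bsub>frac_field R\<^esub> \<noteq> \<one>\<^bsub>frac_field R\<^esub>" by (simp add: ops)
    fix u assume u: "u \<in> carrier (frac_field R)" "u \<noteq> \<zero>\<^bsub>frac_field R\<^esub>"
    then obtain a b where ab: "a \<in> carrier R" "b \<in> carrier R" "b \<noteq> \<zero>" "u = fraction R a b"
      by (blast elim: frac_fieldE)
    with u have a: "a \<noteq> \<zero>" by (auto simp: ops)
    have "u \<otimes>\<^bsub>frac_field R\<^esub> fraction R b a = \<one>\<^bsub>frac_field R\<^esub>"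
      using a ab by (simp add: ops m_ac)
    then show "\<exists>v\<in>carrier (frac_field R). u \<otimes>\<^bsub>frac_field R\<^esub> v = \<one>\<^bsub>frac_field R\<^esub>"
      using a ab by (meson fraction_in_frac_field)
  qed
qed

lemma (in domain) fraction_hom: "(\<lambda>r. fraction R r \<one>) \<in> ring_hom R (frac_field R)"
  by (rule ring_hom_memI) (simp_all add: mult_fraction add_fraction one_frac_field
      fraction_in_frac_field)

section \<open>Quotient modules and extension of scalars\<close>

text \<open>Stated for an arbitrary abelian group so that it covers both the cofixed module and the
  tensor product. The module laws are assumed only modulo \<open>N\<close>, because on the free
  group behind the tensor product additivity in the scalar fails before passing to cosets.\<close>

lemma (in comm_group)
  fixes R (structure) and \<phi> :: "'r \<Rightarrow> 'a \<Rightarrow> 'a"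
  assumes R: "cring R" and N: "subgroup N G"
    and hom: "\<And>r. r \<in> carrier R \<Longrightarrow> \<phi> r \<in> hom G G"
    and N_closed: "\<And>r x. r \<in> carrier R \<Longrightarrow> x \<in> N \<Longrightarrow> \<phi> r x \<in> N"
    and add: "\<And>r s x. r \<in> carrier R \<Longrightarrow> s \<in> carrier R \<Longrightarrow> x \<in> carrier G \<Longrightarrow>
      N #> \<phi> (r \<oplus>\<^bsub>R\<^esub> s) x = N #> (\<phi> r x \<otimes> \<phi> s x)"
    and mult: "\<And>r s x. r \<in> carrier R \<Longrightarrow> s \<in> carrier R \<Longrightarrow> x \<in> carrier G \<Longrightarrow>
      N #> \<phi> (r \<otimes>\<^bsub>R\<^esub> s) x = N #> \<phi> r (\<phi> s x)"
    and one: "\<And>x. x \<in> carrier G \<Longrightarrow> N #> \<phi> \<one>\<^bsub>R\<^esub> x = N #> x"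
  shows quotient_smult: "\<And>r x. r \<in> carrier R \<Longrightarrow> x \<in> carrier G \<Longrightarrow>
      (\<Union>y\<in>N #> x. N #> \<phi> r y) = N #> \<phi> r x"
    and quotient_module: "module R \<lparr>carrier = rcosets N, mult = m, one = e, ring.zero = N, add = set_mult G,
      smult = \<lambda>r U. \<Union>x\<in>U. N #> \<phi> r x\<rparr>" (is "module R ?M")
proof -
  interpret normal N G using N by (simp add: subgroup_imp_normal)
  have closed: "\<phi> r x \<in> carrier G" if "r \<in> carrier R" "x \<in> carrier G" for r x
    using hom[OF that(1)] that(2) by (rule hom_in_carrier)
  show smult: "(\<Union>y\<in>N #> x. N #> \<phi> r y) = N #> \<phi> r x" if r: "r \<in> carrier R" and x: "x \<in> carrier G" for r x
  proof -
    have "N #> \<phi> r y = N #> \<phi> r x" if y: "y \<in> N #> x" for y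
    proof -
      obtain n where n: "n \<in> N" "y = n \<otimes> x" using y by (auto simp: r_coset_def)
      \<comment> \<open>Changing the representative by \<open>n\<close> changes the image by
        \<open>\<phi> r n\<close>, which stays in \<open>N\<close>.\<close>
      have "\<phi> r y = \<phi> r n \<otimes> \<phi> r x"
        using hom_mult[OF hom[OF r]] n x subset by auto
      then have "\<phi> r y \<in> N #> \<phi> r x" using N_closed[OF r n(1)] by (auto simp: r_coset_def)
      then show ?thesis using repr_independence[OF _ closed[OF r x] N] by simp
    qed
    moreover have "x \<in> N #> x" using x N by (rule rcos_self)
    ultimately show ?thesis by blast
  qed
  have cg: "comm_group (G Mod N)"
    using factorgroup_is_group
    by (rule group.group_comm_groupI) (auto simp: FactGroup_def RCOSETS_def rcos_sum m_comm)
  then interpret Q: comm_group "G Mod N" .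
  \<comment> \<open>The additive part of the record is the factor group \<open>G Mod N\<close>, so
    its laws carry over.\<close>
  have ab: "abelian_group ?M"
    using Q.m_closed Q.one_closed Q.m_assoc Q.m_comm Q.l_one Q.l_inv_ex
    by (intro abelian_groupI) (simp_all add: FactGroup_def)
  show "module R ?M"
  proof (rule moduleI[OF R ab])
    fix r U assume r: "r \<in> carrier R" and "U \<in> carrier ?M"
    then obtain x where x: "x \<in> carrier G" "U = N #> x" by (auto simp: RCOSETS_def)
    show "r \<odot>\<^bsub>?M\<^esub> U \<in> carrier ?M"
      using r x by (auto simp: smult RCOSETS_def intro!: closed)
    fix s assume s: "s \<in> carrier R"
    show "(r \<oplus>\<^bsub>R\<^esub> s) \<odot>\<^bsub>?M\<^esub> U = r \<odot>\<^bsub>?M\<^esub> U \<oplus>\<^bsub>?M\<^esub> s \<odot>\<^bsub>?M\<^esub> U"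
      using r s x R by (simp add: smult add rcos_sum closed cring.cring_simprules(1))
    show "(r \<otimes>\<^bsub>R\<^esub> s) \<odot>\<^bsub>?M\<^esub> U = r \<odot>\<^bsub>?M\<^esub> (s \<odot>\<^bsub>?M\<^esub> U)"
      using r s x R by (simp add: smult mult closed cring.cring_simprules(5))
  next
    fix r U V assume r: "r \<in> carrier R" and "U \<in> carrier ?M" "V \<in> carrier ?M"
    then obtain x y where x: "x \<in> carrier G" "U = N #> x" and y: "y \<in> carrier G" "V = N #> y"
      by (auto simp: RCOSETS_def)
    show "r \<odot>\<^bsub>?M\<^esub> (U \<oplus>\<^bsub>?M\<^esub> V) = r \<odot>\<^bsub>?M\<^esub> U \<oplus>\<^bsub>?M\<^esub> r \<odot>\<^bsub>?M\<^esub> V"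
      using r x y by (simp add: smult rcos_sum closed hom_mult[OF hom])
  next
    fix U assume "U \<in> carrier ?M"
    then obtain x where x: "x \<in> carrier G" "U = N #> x" by (auto simp: RCOSETS_def)
    show "\<one>\<^bsub>R\<^esub> \<odot>\<^bsub>?M\<^esub> U = U"
      using x R by (simp add: smult one cring.cring_simprules(6))
  qed
qed

lemma (in group) rcos_eqI:
  assumes "subgroup N G" "x \<in> carrier G" "y \<in> carrier G" "x \<otimes> inv y \<in> N"
  shows "N #> x = N #> y"
proof (rule repr_independence[symmetric])
  have "x = (x \<otimes> inv y) \<otimes> y"
    using assms by (simp add: m_assoc)
  then show "x \<in> N #> y"
    using assms(4) unfolding r_coset_def by blast
qed (use assms in auto)

lemma free_Abelian_group_minus_closed:
  "x \<in> carrier (free_Abelian_group S) \<Longrightarrow> y \<in> carrier (free_Abelian_group S) \<Longrightarrow>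
    x - y \<in> carrier (free_Abelian_group S)"
  using keys_diff[of x y] by auto

section \<open>Scalar extension along a ring homomorphism\<close>

locale ring_extension_module = module R M + A?: cring A
  for R (structure) and M (structure) and A (structure) +
  fixes \<phi>
  assumes \<phi>: "\<phi> \<in> ring_hom R A"
begin

abbreviation F where "F \<equiv> free_Abelian_group (carrier A \<times> carrier M)"
abbreviation N where "N \<equiv> tensor_kernel R A \<phi> M"
abbreviation act where "act a \<equiv> frag_extend (\<lambda>(b, m). frag_of (a \<otimes>\<^bsub>A\<^esub> b, m))"

lemma tensor_relations_subset: "tensor_relations R A \<phi> M \<subseteq> carrier F"
  unfolding tensor_relations_def
  by (auto intro!: free_Abelian_group_minus_closed ring_hom_closed[OF \<phi>] simp del: carrier_free_Abelian_group_iff)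

lemma subgroup_tensor_kernel: "subgroup N F"
  unfolding tensor_kernel_def
  by (rule group.generate_is_subgroup[OF group_free_Abelian_group tensor_relations_subset])

lemma tensor_kernel_subset: "N \<subseteq> carrier F"
  by (rule subgroup.subset[OF subgroup_tensor_kernel])

lemma tensor_kernel_zero: "0 \<in> N"
  using subgroup.one_closed[OF subgroup_tensor_kernel] by simp

lemma tensor_kernel_add: "x \<in> N \<Longrightarrow> y \<in> N \<Longrightarrow> x + y \<in> N"
  using subgroup.m_closed[OF subgroup_tensor_kernel] by simp

lemma tensor_kernel_uminus: "x \<in> N \<Longrightarrow> - x \<in> N"
  using subgroup.m_inv_closed[OF subgroup_tensor_kernel, of x] tensor_kernel_subset by auto

lemma tensor_kernel_minus: "x \<in> N \<Longrightarrow> y \<in> N \<Longrightarrow> x - y \<in> N"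
  using tensor_kernel_add[of x "- y"] tensor_kernel_uminus[of y] by simp

lemma tensor_kernel_add_left:
  "a \<in> carrier A \<Longrightarrow> a' \<in> carrier A \<Longrightarrow> m \<in> carrier M \<Longrightarrow>
    frag_of (a \<oplus>\<^bsub>A\<^esub> a', m) - frag_of (a, m) - frag_of (a', m) \<in> N"
  unfolding tensor_kernel_def tensor_relations_def by (rule generate.incl) blast

lemma tensor_kernel_balanced:
  "a \<in> carrier A \<Longrightarrow> r \<in> carrier R \<Longrightarrow> m \<in> carrier M \<Longrightarrow>
    frag_of (a \<otimes>\<^bsub>A\<^esub> \<phi> r, m) - frag_of (a, r \<odot>\<^bsub>M\<^esub> m) \<in> N"
  unfolding tensor_kernel_def tensor_relations_def by (rule generate.incl) blast

lemma tensor_coset_eqI: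
  assumes "x \<in> carrier F" "y \<in> carrier F" "x - y \<in> N"
  shows "N #>\<^bsub>F\<^esub> x = N #>\<^bsub>F\<^esub> y"
  using assms by (intro group.rcos_eqI subgroup_tensor_kernel) auto

lemma act_closed:
  assumes "a \<in> carrier A" "x \<in> carrier F" shows "act a x \<in> carrier F"
  using assms keys_frag_extend[of "\<lambda>(b, m). frag_of (a \<otimes>\<^bsub>A\<^esub> b, m)" x]
  by (fastforce simp: keys_frag_of)

lemma tensor_relations_cases:
  assumes "x \<in> tensor_relations R A \<phi> M"
  obtains (add_left) a a' m where "a \<in> carrier A" "a' \<in> carrier A" "m \<in> carrier M"
      "x = frag_of (a \<oplus>\<^bsub>A\<^esub> a', m) - frag_of (a, m) - frag_of (a', m)"
    | (add_right) a m m' where "a \<in> carrier A" "m \<in> carrier M" "m' \<in> carrier M"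
      "x = frag_of (a, m \<oplus>\<^bsub>M\<^esub> m') - frag_of (a, m) - frag_of (a, m')"
    | (balanced) a r m where "a \<in> carrier A" "r \<in> carrier R" "m \<in> carrier M"
      "x = frag_of (a \<otimes>\<^bsub>A\<^esub> \<phi> r, m) - frag_of (a, r \<odot>\<^bsub>M\<^esub> m)"
  using assms unfolding tensor_relations_def
  by (elim UnE CollectE exE conjE) (rule that; assumption)+

text \<open>Multiplying first components keeps each family of relations: left additivity by
  distributivity, balancedness by associativity, and right additivity directly.\<close>

lemma act_tensor_relations:
  assumes a: "a \<in> carrier A" and x: "x \<in> tensor_relations R A \<phi> M"
  shows "act a x \<in> tensor_relations R A \<phi> M"
  using x
proof (cases rule: tensor_relations_cases)
  case (add_left b b' m)
  with a have "act a x = frag_of (a \<otimes>\<^bsub>A\<^esub> b \<oplus>\<^bsub>A\<^esub> a \<otimes>\<^bsub>A\<^esub> b', m)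
      - frag_of (a \<otimes>\<^bsub>A\<^esub> b, m) - frag_of (a \<otimes>\<^bsub>A\<^esub> b', m)"
    by (simp add: frag_extend_diff A.r_distr)
  moreover have "a \<otimes>\<^bsub>A\<^esub> b \<in> carrier A" "a \<otimes>\<^bsub>A\<^esub> b' \<in> carrier A"
    using a add_left by simp_all
  ultimately show ?thesis
    using add_left(3) unfolding tensor_relations_def by blast
next
  case (add_right b m m')
  then have "act a x = frag_of (a \<otimes>\<^bsub>A\<^esub> b, m \<oplus>\<^bsub>M\<^esub> m')
      - frag_of (a \<otimes>\<^bsub>A\<^esub> b, m) - frag_of (a \<otimes>\<^bsub>A\<^esub> b, m')"
    by (simp add: frag_extend_diff)
  moreover have "a \<otimes>\<^bsub>A\<^esub> b \<in> carrier A"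
    using a add_right by simp
  ultimately show ?thesis
    using add_right(2,3) unfolding tensor_relations_def by blast
next
  case (balanced b r m)
  with a have "act a x = frag_of ((a \<otimes>\<^bsub>A\<^esub> b) \<otimes>\<^bsub>A\<^esub> \<phi> r, m) - frag_of (a \<otimes>\<^bsub>A\<^esub> b, r \<odot>\<^bsub>M\<^esub> m)"
    by (simp add: frag_extend_diff A.m_assoc ring_hom_closed[OF \<phi>])
  moreover have "a \<otimes>\<^bsub>A\<^esub> b \<in> carrier A"
    using a balanced by simp
  ultimately show ?thesis
    using balanced(2,3) unfolding tensor_relations_def by blast
qed

lemma act_tensor_kernel:
  assumes a: "a \<in> carrier A" and x: "x \<in> N"
  shows "act a x \<in> N"
  using x[unfolded tensor_kernel_def]
proof (induction rule: generate.induct)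
  case one
  then show ?case by (simp add: tensor_kernel_zero)
next
  case (incl h)
  then show ?case using act_tensor_relations[OF a] by (auto simp: tensor_kernel_def intro: generate.incl)
next
  case (inv h)
  then have "act a h \<in> N"
    using act_tensor_relations[OF a] by (auto simp: tensor_kernel_def intro: generate.incl)
  moreover have "inv\<^bsub>F\<^esub> h = - h" using inv tensor_relations_subset by auto
  ultimately show ?case by (simp add: frag_extend_minus tensor_kernel_uminus)
next
  case (eng h1 h2)
  then show ?case by (simp add: frag_extend_add tensor_kernel_add)
qed

lemma act_hom:
  assumes "a \<in> carrier A"
  shows "act a \<in> hom F F"
  using act_closed[OF assms] by (intro homI) (simp_all add: frag_extend_add)

text \<open>On a basis symbol the two sides differ by a left additivity relation, so they agree only
  as cosets, unlike in \<open>act_mult\<close> and \<open>act_one\<close>, which are exact.\<close>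

lemma act_add:
  assumes a: "a \<in> carrier A" "b \<in> carrier A" and x: "x \<in> carrier F"
  shows "N #>\<^bsub>F\<^esub> act (a \<oplus>\<^bsub>A\<^esub> b) x = N #>\<^bsub>F\<^esub> (act a x \<otimes>\<^bsub>F\<^esub> act b x)"
proof (rule tensor_coset_eqI)
  show "act (a \<oplus>\<^bsub>A\<^esub> b) x - (act a x \<otimes>\<^bsub>F\<^esub> act b x) \<in> N"
    using x[unfolded carrier_free_Abelian_group_iff]
  proof (induction x rule: frag_induction)
    case zero
    show ?case by (simp add: tensor_kernel_zero)
  next
    case (one p)
    then show ?case
      using a tensor_kernel_add_left[of "a \<otimes>\<^bsub>A\<^esub> fst p" "b \<otimes>\<^bsub>A\<^esub> fst p" "snd p"]
      by (auto simp: A.l_distr diff_diff_eq)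
  next
    case (diff x y)
    have "act (a \<oplus>\<^bsub>A\<^esub> b) (x - y) - (act a (x - y) + act b (x - y)) =
      (act (a \<oplus>\<^bsub>A\<^esub> b) x - (act a x + act b x)) - (act (a \<oplus>\<^bsub>A\<^esub> b) y - (act a y + act b y))"
      by (simp add: frag_extend_diff)
    then show ?case using tensor_kernel_minus[OF diff] by simp
  qed
qed (use a x act_closed in \<open>auto intro!: monoid.m_closed group.is_monoid simp del: carrier_free_Abelian_group_iff mult_free_Abelian_group\<close>)

lemma act_mult:
  assumes a: "a \<in> carrier A" "b \<in> carrier A" and x: "x \<in> carrier F"
  shows "act (a \<otimes>\<^bsub>A\<^esub> b) x = act a (act b x)"
  using x[unfolded carrier_free_Abelian_group_iff]
  by (induction x rule: frag_induction) (use a in \<open>auto simp: frag_extend_diff A.m_assoc\<close>)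

lemma act_one:
  assumes x: "x \<in> carrier F"
  shows "act \<one>\<^bsub>A\<^esub> x = x"
  using x[unfolded carrier_free_Abelian_group_iff]
  by (induction x rule: frag_induction) (auto simp: frag_extend_diff)

text \<open>The hypotheses of \<open>quotient_module\<close> in order; \<open>arg_cong\<close>
  passes from exact identities to cosets.\<close>

lemmas act_quotient = abelian_free_Abelian_group A.is_cring subgroup_tensor_kernel act_hom
  act_tensor_kernel act_add act_mult[THEN arg_cong] act_one[THEN arg_cong]

lemma smult_scalar_extension:
  assumes "a \<in> carrier A" "x \<in> carrier F"
  shows "a \<odot>\<^bsub>scalar_extension R A \<phi> M\<^esub> (N #>\<^bsub>F\<^esub> x) = N #>\<^bsub>F\<^esub> act a x"
  using comm_group.quotient_smult[where \<phi> = act, OF act_quotient assms]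
  by (simp add: scalar_extension_def Let_def)

lemma module_scalar_extension: "module A (scalar_extension R A \<phi> M)"
  using comm_group.quotient_module[where \<phi> = act, OF act_quotient]
  by (simp add: scalar_extension_def Let_def)

text \<open>This serves to show that an element lies outside \<open>N\<close>: it suffices that
  \<open>T\<close> does not kill it. Hence \<open>T\<close> is given on \<open>F\<close> with
  \<open>N\<close> in its kernel rather than on the quotient.\<close>

lemma tensor_kernel_universal:
  fixes H (structure)
  assumes "comm_group H"
    and closed: "\<And>a m. a \<in> carrier A \<Longrightarrow> m \<in> carrier M \<Longrightarrow> \<beta> a m \<in> carrier H"
    and add_left: "\<And>a a' m. a \<in> carrier A \<Longrightarrow> a' \<in> carrier A \<Longrightarrow> m \<in> carrier M \<Longrightarrow>
      \<beta> (a \<oplus>\<^bsub>A\<^esub> a') m = \<beta> a m \<otimes>\<^bsub>H\<^esub> \<beta> a' m"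
    and add_right: "\<And>a m m'. a \<in> carrier A \<Longrightarrow> m \<in> carrier M \<Longrightarrow> m' \<in> carrier M \<Longrightarrow>
      \<beta> a (m \<oplus>\<^bsub>M\<^esub> m') = \<beta> a m \<otimes>\<^bsub>H\<^esub> \<beta> a m'"
    and balanced: "\<And>a r m. a \<in> carrier A \<Longrightarrow> r \<in> carrier R \<Longrightarrow> m \<in> carrier M \<Longrightarrow>
      \<beta> (a \<otimes>\<^bsub>A\<^esub> \<phi> r) m = \<beta> a (r \<odot>\<^bsub>M\<^esub> m)"
  obtains T where "T \<in> hom F H" "N \<subseteq> kernel F H T"
    "\<And>a m. a \<in> carrier A \<Longrightarrow> m \<in> carrier M \<Longrightarrow> T (frag_of (a, m)) = \<beta> a m"
proof -
  interpret H: comm_group H by fact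
  have "case_prod \<beta> ` (carrier A \<times> carrier M) \<subseteq> carrier H"
    using closed by auto
  then obtain T where T: "T \<in> hom F H"
    and T_of': "\<And>p. p \<in> carrier A \<times> carrier M \<Longrightarrow> T (frag_of p) = case_prod \<beta> p"
    using H.free_Abelian_group_universal by blast
  have T_of: "T (frag_of (a, m)) = \<beta> a m" if "a \<in> carrier A" "m \<in> carrier M" for a m
    using T_of'[of "(a, m)"] that by simp
  interpret T: group_hom F H T
    using T by (intro group_hom.intro group_hom_axioms.intro group_free_Abelian_group H.is_group)
  have T_diff: "T (x - y) = T x \<otimes>\<^bsub>H\<^esub> inv\<^bsub>H\<^esub> T y" if "x \<in> carrier F" "y \<in> carrier F" for x y
    using T.hom_mult[of x "inv\<^bsub>F\<^esub> y"] that by (simp add: T.hom_inv[symmetric])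
  have "T y = \<one>\<^bsub>H\<^esub>" if "y \<in> tensor_relations R A \<phi> M" for y
    using that
  proof (cases rule: tensor_relations_cases)
    case (add_left a a' m)
    then have "T y = (\<beta> a m \<otimes>\<^bsub>H\<^esub> \<beta> a' m) \<otimes>\<^bsub>H\<^esub> inv\<^bsub>H\<^esub> \<beta> a m \<otimes>\<^bsub>H\<^esub> inv\<^bsub>H\<^esub> \<beta> a' m"
      by (simp add: T_diff free_Abelian_group_minus_closed[simplified] T_of assms(3))
    then show ?thesis
      using add_left closed by (simp add: H.m_ac)
  next
    case (add_right a m m')
    then have "T y = (\<beta> a m \<otimes>\<^bsub>H\<^esub> \<beta> a m') \<otimes>\<^bsub>H\<^esub> inv\<^bsub>H\<^esub> \<beta> a m \<otimes>\<^bsub>H\<^esub> inv\<^bsub>H\<^esub> \<beta> a m'"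
      by (simp add: T_diff free_Abelian_group_minus_closed[simplified] T_of assms(4))
    then show ?thesis
      using add_right closed by (simp add: H.m_ac)
  next
    case (balanced a r m)
    then show ?thesis
      using closed ring_hom_closed[OF \<phi>] by (simp add: T_diff T_of assms(5))
  qed
  then have "tensor_relations R A \<phi> M \<subseteq> kernel F H T"
    using tensor_relations_subset unfolding kernel_def by blast
  then have "N \<subseteq> kernel F H T"
    unfolding tensor_kernel_def by (rule T.G.generate_subgroup_incl[OF _ T.subgroup_kernel])
  then show thesis
    using that T T_of by blast
qed

end

section \<open>Modules of rank one\<close>

text \<open>The linear form \<open>t\<close> induces an isomorphism \<open>K \<otimes> M \<cong> K\<close>: as \<open>t x\<close> is invertible in \<open>K\<close>,
  every \<open>m\<close> becomes the multiple \<open>t m / t x\<close> of \<open>x\<close>.\<close>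

theorem module_rank_eq_1:
  assumes "domain R" and "module R M"
    and t_closed: "\<And>m. m \<in> carrier M \<Longrightarrow> t m \<in> carrier R"
    and t_add: "\<And>m n. m \<in> carrier M \<Longrightarrow> n \<in> carrier M \<Longrightarrow> t (m \<oplus>\<^bsub>M\<^esub> n) = t m \<oplus>\<^bsub>R\<^esub> t n"
    and t_smult: "\<And>r m. r \<in> carrier R \<Longrightarrow> m \<in> carrier M \<Longrightarrow> t (r \<odot>\<^bsub>M\<^esub> m) = r \<otimes>\<^bsub>R\<^esub> t m"
    and x: "x \<in> carrier M" "t x \<noteq> \<zero>\<^bsub>R\<^esub>"
    and tx_smult: "\<And>m. m \<in> carrier M \<Longrightarrow> t x \<odot>\<^bsub>M\<^esub> m = t m \<odot>\<^bsub>M\<^esub> x"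
  shows "module_rank R M = 1"
proof -
  interpret R: domain R by fact
  define K where "K = frac_field R"
  define \<phi> where "\<phi> = (\<lambda>r. fraction R r \<one>\<^bsub>R\<^esub>)"
  define V where "V = scalar_extension R K \<phi> M"
  have \<phi>: "\<phi> \<in> ring_hom R K"
    unfolding \<phi>_def K_def by (rule R.fraction_hom)
  interpret K: field K
    unfolding K_def by (rule R.field_frac_field)
  interpret ring_extension_module R M K \<phi>
    using assms(2) K.is_cring \<phi> by (intro ring_extension_module.intro ring_extension_module_axioms.intro)
  interpret V: vectorspace K V
    unfolding V_def by (intro vectorspace.intro module_scalar_extension K.field_axioms)
  have carrier_V: "carrier V = rcosets\<^bsub>F\<^esub> N" and zero_V: "\<zero>\<^bsub>V\<^esub> = N"
    by (simp_all add: V_def scalar_extension_def Let_def)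
  have \<phi>_closed: "\<phi> r \<in> carrier K" if "r \<in> carrier R" for r
    using \<phi> that by (rule ring_hom_closed)
  \<comment> \<open>\<open>\<phi>\<close> is injective, so \<open>t x\<close> stays nonzero in the
    field \<open>K\<close>.\<close>
  have tx: "\<phi> (t x) \<in> Units K"
    using x t_closed[OF x(1)] R.fraction_eq_iff[of "t x" "\<one>\<^bsub>R\<^esub>" "\<zero>\<^bsub>R\<^esub>" "\<one>\<^bsub>R\<^esub>"]
    by (simp add: K.field_Units \<phi>_closed) (simp add: \<phi>_def K_def R.zero_frac_field)
  define v where "v = N #>\<^bsub>F\<^esub> frag_of (\<one>\<^bsub>K\<^esub>, x)"
  have v: "v \<in> carrier V"
    unfolding v_def carrier_V
    by (rule group.rcosetsI[OF group_free_Abelian_group tensor_kernel_subset]) (simp add: x)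
  have smult_v: "k \<odot>\<^bsub>V\<^esub> v = N #>\<^bsub>F\<^esub> frag_of (k, x)" if "k \<in> carrier K" for k
    using smult_scalar_extension[OF that, of "frag_of (\<one>\<^bsub>K\<^esub>, x)"] x that by (simp add: v_def V_def)

  have "v \<noteq> \<zero>\<^bsub>V\<^esub>"
  proof
    assume "v = \<zero>\<^bsub>V\<^esub>"
    then have "N #>\<^bsub>F\<^esub> frag_of (\<one>\<^bsub>K\<^esub>, x) = N"
      by (simp add: v_def zero_V)
    then have in_N: "frag_of (\<one>\<^bsub>K\<^esub>, x) \<in> N"
      using group.rcos_self[OF group_free_Abelian_group _ subgroup_tensor_kernel, of "frag_of (\<one>\<^bsub>K\<^esub>, x)"] x
      by simp
    \<comment> \<open>The form induced by \<open>t\<close> after extending scalars; it sends the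
      symbol for \<open>v\<close> to \<open>\<phi> (t x)\<close>, a unit.\<close>
    obtain T where "T \<in> hom F (add_monoid K)" and T: "N \<subseteq> kernel F (add_monoid K) T"
      "\<And>a m. a \<in> carrier K \<Longrightarrow> m \<in> carrier M \<Longrightarrow> T (frag_of (a, m)) = a \<otimes>\<^bsub>K\<^esub> \<phi> (t m)"
      by (rule tensor_kernel_universal[OF K.a_comm_group, where \<beta> = "\<lambda>a m. a \<otimes>\<^bsub>K\<^esub> \<phi> (t m)"])
        (simp_all add: \<phi>_closed t_closed t_add t_smult ring_hom_add[OF \<phi>] ring_hom_mult[OF \<phi>]
          K.l_distr K.r_distr K.m_assoc)
    from in_N T(1) have "T (frag_of (\<one>\<^bsub>K\<^esub>, x)) = \<zero>\<^bsub>K\<^esub>"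
      by (auto simp: kernel_def)
    then have "\<phi> (t x) = \<zero>\<^bsub>K\<^esub>"
      using x by (simp add: T(2) \<phi>_closed t_closed)
    with tx show False
      by (simp add: K.field_Units)
  qed

  have ex: "\<exists>k\<in>carrier K. f - frag_of (k, x) \<in> N" if "f \<in> carrier F" for f
    using that[unfolded carrier_free_Abelian_group_iff]
  proof (induction f rule: frag_induction)
    case zero
    \<comment> \<open>The symbol with first entry zero is not the zero of \<open>F\<close>; the
      relation for 0 + 0 = 0 is exactly its negative.\<close>
    have "0 - frag_of (\<zero>\<^bsub>K\<^esub>, x) \<in> N"
      using tensor_kernel_add_left[of "\<zero>\<^bsub>K\<^esub>" "\<zero>\<^bsub>K\<^esub>" x] x by simp
    then show ?case by blast
  next
    case (one p)
    then obtain a m where p: "p = (a, m)" "a \<in> carrier K" "m \<in> carrier M" by auto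
    \<comment> \<open>Write \<open>a\<close> as \<open>b\<close> times \<open>\<phi> (t x)\<close>.
      Balancing moves \<open>t x\<close> onto \<open>m\<close>, \<open>tx_smult\<close> turns the
      result into \<open>t m\<close> times \<open>x\<close>, and balancing moves \<open>t m\<close>
      back to the left.\<close>
    define b where "b = a \<otimes>\<^bsub>K\<^esub> inv\<^bsub>K\<^esub> \<phi> (t x)"
    have b: "b \<in> carrier K" "b \<otimes>\<^bsub>K\<^esub> \<phi> (t x) = a"
      using p tx by (simp_all add: b_def K.m_assoc K.Units_closed K.Units_inv_closed)
    have *: "frag_of (a, m) - frag_of (b, t x \<odot>\<^bsub>M\<^esub> m) \<in> N"
      using tensor_kernel_balanced[OF b(1) t_closed[OF x(1)] p(3)] b(2) by simp
    have **: "frag_of (b \<otimes>\<^bsub>K\<^esub> \<phi> (t m), x) - frag_of (b, t m \<odot>\<^bsub>M\<^esub> x) \<in> N"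
      using tensor_kernel_balanced[OF b(1) t_closed[OF p(3)] x(1)] .
    have "frag_of p - frag_of (b \<otimes>\<^bsub>K\<^esub> \<phi> (t m), x) \<in> N"
      using tensor_kernel_minus[OF * **] by (simp add: p tx_smult)
    then show ?case
      using b p \<phi>_closed t_closed by blast
  next
    case (diff f g)
    then obtain k l where k: "k \<in> carrier K" "f - frag_of (k, x) \<in> N"
      and l: "l \<in> carrier K" "g - frag_of (l, x) \<in> N" by blast
    \<comment> \<open>Left additivity for k = (k - l) + l.\<close>
    have "frag_of (k, x) - frag_of (k \<ominus>\<^bsub>K\<^esub> l, x) - frag_of (l, x) \<in> N"
      using tensor_kernel_add_left[of "k \<ominus>\<^bsub>K\<^esub> l" l x] k l x
      by (simp add: a_minus_def K.a_assoc K.l_neg)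
    from tensor_kernel_add[OF tensor_kernel_minus[OF k(2) l(2)] this]
    have "(f - g) - frag_of (k \<ominus>\<^bsub>K\<^esub> l, x) \<in> N"
      by (simp add: algebra_simps)
    then show ?case
      using k l by blast
  qed
  have "V.gen_set {v}"
  proof
    show "V.span {v} \<subseteq> carrier V"
      using v by (simp add: V.span_is_subset2)
    show "carrier V \<subseteq> V.span {v}"
    proof
      fix u assume "u \<in> carrier V"
      then obtain f where f: "f \<in> carrier F" "u = N #>\<^bsub>F\<^esub> f"
        by (auto simp: carrier_V RCOSETS_def)
      obtain k where k: "k \<in> carrier K" "f - frag_of (k, x) \<in> N"
        using ex f by blast
      then have "u = k \<odot>\<^bsub>V\<^esub> v"
        using f x by (simp add: smult_v tensor_coset_eqI)
      then show "u \<in> V.span {v}"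
        using submodule.smult_closed[OF V.span_is_submodule[of "{v}"] k(1)] V.in_own_span[of "{v}"] v
        by simp
    qed
  qed
  moreover from this have "V.fin_dim"
    using v unfolding V.fin_dim_def by blast
  ultimately show ?thesis
    using V.dim1I[of v] \<open>v \<noteq> \<zero>\<^bsub>V\<^esub>\<close> v
    by (simp add: module_rank_def one_enat_def flip: V_def K_def \<phi>_def)
qed

section \<open>Independence of characters and the trace\<close>

text \<open>Subtracting \<open>h y\<close> times the relation at \<open>x\<close> from the relation at \<open>x y\<close> eliminates \<open>h\<close>.\<close>

lemma (in domain) Dedekind_independence:
  assumes "monoid M" "finite F" "F \<subseteq> hom M R \<inter> extensional (carrier M)"
    and one: "\<And>h. h \<in> F \<Longrightarrow> h \<one>\<^bsub>M\<^esub> = \<one>"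
    and "a \<in> F \<rightarrow> carrier R"
    and "\<And>x. x \<in> carrier M \<Longrightarrow> (\<Oplus>h\<in>F. a h \<otimes> h x) = \<zero>"
    and "h \<in> F"
  shows "a h = \<zero>"
  using assms(2-)
proof (induction F arbitrary: a h rule: finite_induct)
  case empty
  then show ?case by simp
next
  case (insert f F)
  interpret M: monoid M by fact
  have closed: "h x \<in> carrier R" if "h \<in> insert f F" "x \<in> carrier M" for h x
    using insert.prems(1) that by (auto simp: hom_def)
  have mult: "h (x \<otimes>\<^bsub>M\<^esub> y) = h x \<otimes> h y" if "h \<in> insert f F" "x \<in> carrier M" "y \<in> carrier M" for h x y
    using insert.prems(1) that by (auto simp: hom_def)
  have a: "a h \<in> carrier R" if "h \<in> insert f F" for h
    using insert.prems(3) that by auto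
  have rel: "(\<Oplus>h\<in>F. a h \<otimes> h x) = \<ominus> (a f \<otimes> f x)" if x: "x \<in> carrier M" for x
  proof -
    have "a f \<otimes> f x \<oplus> (\<Oplus>h\<in>F. a h \<otimes> h x) = \<zero>"
      using insert.prems(4)[OF x] insert.hyps a closed x by (simp add: finsum_insert)
    then show ?thesis
      using a closed x by (intro minus_equality[symmetric]) (auto simp: a_comm)
  qed
  have F: "a h = \<zero>" if h: "h \<in> F" for h
  proof -
    \<comment> \<open>Distinct functions extensional on the carrier of \<open>M\<close> must differ
      at some \<open>y\<close> in that carrier.\<close>
    have "h \<noteq> f" "h \<in> extensional (carrier M)" "f \<in> extensional (carrier M)"
      using h insert by auto
    then obtain y where y: "y \<in> carrier M" "h y \<noteq> f y"
      by (meson extensionalityI)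
    have "a h \<otimes> (h y \<ominus> f y) = \<zero>"
    \<comment> \<open>The combined relation would have coefficient zero at \<open>f\<close>, so it
      involves only \<open>F\<close> and the induction hypothesis applies.\<close>
    proof (rule insert.IH[of "\<lambda>k. a k \<otimes> (k y \<ominus> f y)"])
      fix x assume x: "x \<in> carrier M"
      \<comment> \<open>Multiplicativity absorbs \<open>k y\<close> into the argument and
        \<open>f y\<close> factors out of the sum, so that two instances of \<open>rel\<close>
        cancel.\<close>
      have *: "a k \<otimes> (k y \<ominus> f y) \<otimes> k x = a k \<otimes> k (x \<otimes>\<^bsub>M\<^esub> y) \<oplus> \<ominus> f y \<otimes> (a k \<otimes> k x)"
        if "k \<in> F" for k
        using that x y a closed
        by (simp add: mult a_minus_def l_distr r_distr m_ac l_minus r_minus)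
      have "(\<Oplus>k\<in>F. a k \<otimes> (k y \<ominus> f y) \<otimes> k x) =
          (\<Oplus>k\<in>F. a k \<otimes> k (x \<otimes>\<^bsub>M\<^esub> y) \<oplus> \<ominus> f y \<otimes> (a k \<otimes> k x))"
        using * a closed x y by (intro finsum_cong') auto
      also have "\<dots> = (\<Oplus>k\<in>F. a k \<otimes> k (x \<otimes>\<^bsub>M\<^esub> y)) \<oplus> \<ominus> f y \<otimes> (\<Oplus>k\<in>F. a k \<otimes> k x)"
        using insert.hyps a closed x y by (subst finsum_addf) (auto simp: finsum_rdistr)
      also have "\<dots> = \<zero>"
        using a closed x y by (simp add: rel mult m_ac l_minus r_minus l_neg)
      finally show "(\<Oplus>k\<in>F. a k \<otimes> (k y \<ominus> f y) \<otimes> k x) = \<zero>" .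
    next
      fix k assume "k \<in> F"
      then show "k \<one>\<^bsub>M\<^esub> = \<one>" by (intro insert.prems(2)) simp
    qed (use insert.prems(1) h a closed y in auto)
    then show ?thesis
      using y h a closed by (auto simp: integral_iff)
  qed
  \<comment> \<open>With the other coefficients gone, \<open>rel\<close> at the identity, where
    \<open>f\<close> takes the value 1, isolates \<open>a f\<close>.\<close>
  have "(\<Oplus>h\<in>F. a h \<otimes> h \<one>\<^bsub>M\<^esub>) = (\<Oplus>h\<in>F. \<zero>)"
    using F closed by (intro finsum_cong') auto
  then have "\<ominus> (a f) = \<zero>"
    using rel[of "\<one>\<^bsub>M\<^esub>"] insert.prems(2)[of f] a by simp
  then have "a f = \<zero>"
    using a[of f] by (metis insertI1 minus_minus minus_zero)
  then show ?case
    using F insert.prems(5) by auto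
qed

section \<open>The trace of a finite group of automorphisms\<close>

locale finite_automorphism_group = domain S for S (structure) +
  fixes G
  assumes subgroup_G: "subgroup G (BijGroup (carrier S))"
    and G_iso: "G \<subseteq> ring_iso S S"
    and finite_G: "finite G"
begin

lemma G_hom: "g \<in> G \<Longrightarrow> g \<in> ring_hom S S"
  using G_iso by (auto simp: ring_iso_def)

lemmas G_closed = ring_hom_closed[OF G_hom]
  and G_mult = ring_hom_mult[OF G_hom]
  and G_add = ring_hom_add[OF G_hom]
  and G_one = ring_hom_one[OF G_hom]

lemma G_ring_hom_cring: "g \<in> G \<Longrightarrow> ring_hom_cring S S g"
  using G_hom is_cring by (intro ring_hom_cring.intro ring_hom_cring_axioms.intro)

lemma G_minus: "g \<in> G \<Longrightarrow> s \<in> carrier S \<Longrightarrow> g (\<ominus> s) = \<ominus> g s"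
  using ring_hom_cring.hom_a_inv[OF G_ring_hom_cring] .

lemma G_Bij: "g \<in> G \<Longrightarrow> g \<in> Bij (carrier S)"
  using subgroup.subset[OF subgroup_G] by (auto simp: BijGroup_def)

lemma mult_BijGroup_apply:
  "g \<in> G \<Longrightarrow> h \<in> G \<Longrightarrow> s \<in> carrier S \<Longrightarrow> (g \<otimes>\<^bsub>BijGroup (carrier S)\<^esub> h) s = g (h s)"
  by (simp add: BijGroup_def G_Bij compose_def)

definition tr where "tr s = (\<Oplus>g\<in>G. g s)"

lemma tr_closed: "s \<in> carrier S \<Longrightarrow> tr s \<in> carrier S"
  unfolding tr_def using G_closed by (intro finsum_closed) auto

interpretation B: group "BijGroup (carrier S)"
  by (rule group_BijGroup)

lemma G_in_BijGroup: "g \<in> G \<Longrightarrow> g \<in> carrier (BijGroup (carrier S))"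
  using subgroup.subset[OF subgroup_G] by auto

text \<open>An injective self-map of a finite set is a permutation. It is applied to left
  translation, right translation and inversion.\<close>

lemma tr_reindex:
  assumes "inj_on f G" "f ` G \<subseteq> G" "s \<in> carrier S"
  shows "tr s = (\<Oplus>g\<in>G. f g s)"
proof -
  have "f ` G = G"
    using assms finite_G by (intro endo_inj_surj)
  then show ?thesis
    unfolding tr_def using finsum_reindex[of "\<lambda>g. g s" f G] assms G_closed by auto
qed

text \<open>Left translation by \<open>h\<close> permutes the summands. This places the trace in the
  fixed subring.\<close>

lemma G_tr:
  assumes "h \<in> G" "s \<in> carrier S"
  shows "h (tr s) = tr s"
proof -
  have "h (tr s) = (\<Oplus>g\<in>G. h (g s))"
    unfolding tr_def
    using assms G_closed by (subst ring_hom_cring.hom_finsum[OF G_ring_hom_cring]) (auto simp: comp_def)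
  also have "\<dots> = (\<Oplus>g\<in>G. (h \<otimes>\<^bsub>BijGroup (carrier S)\<^esub> g) s)"
    using assms G_closed by (intro finsum_cong') (auto simp: mult_BijGroup_apply)
  also have "\<dots> = tr s"
    using assms subgroup.m_closed[OF subgroup_G] G_in_BijGroup
    by (intro tr_reindex[symmetric]) (auto simp: inj_on_def)
  finally show ?thesis .
qed

text \<open>Right translation by \<open>h\<close> permutes the summands. This makes the trace vanish
  on the generators of the cofixed kernel.\<close>

lemma tr_G:
  assumes "h \<in> G" "s \<in> carrier S"
  shows "tr (h s) = tr s"
proof -
  have "tr (h s) = (\<Oplus>g\<in>G. (g \<otimes>\<^bsub>BijGroup (carrier S)\<^esub> h) s)"
    unfolding tr_def using assms G_closed by (intro finsum_cong') (auto simp: mult_BijGroup_apply)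
  also have "\<dots> = tr s"
    using assms subgroup.m_closed[OF subgroup_G] G_in_BijGroup
    by (intro tr_reindex[symmetric]) (auto simp: inj_on_def)
  finally show ?thesis .
qed

lemma tr_inverses:
  assumes "s \<in> carrier S"
  shows "tr s = (\<Oplus>g\<in>G. (inv\<^bsub>BijGroup (carrier S)\<^esub> g) s)"
  using assms subgroup.m_inv_closed[OF subgroup_G] G_in_BijGroup B.inv_inv
  by (intro tr_reindex) (auto intro!: inj_onI dest: B.inv_inj[THEN inj_onD])

lemma tr_add:
  assumes "s \<in> carrier S" "s' \<in> carrier S"
  shows "tr (s \<oplus> s') = tr s \<oplus> tr s'"
proof -
  have "tr (s \<oplus> s') = (\<Oplus>g\<in>G. g s \<oplus> g s')"
    unfolding tr_def using assms G_closed by (intro finsum_cong') (auto simp: G_add)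
  then show ?thesis
    using assms G_closed by (simp add: tr_def finsum_addf Pi_def)
qed

lemma tr_hom: "tr \<in> hom (add_monoid S) (add_monoid S)"
  by (intro homI) (simp_all add: tr_closed tr_add)

lemma tr_mult_fixed:
  assumes "r \<in> carrier S" "\<And>g. g \<in> G \<Longrightarrow> g r = r" "s \<in> carrier S"
  shows "tr (r \<otimes> s) = r \<otimes> tr s"
proof -
  have *: "g (r \<otimes> s) = r \<otimes> g s" if "g \<in> G" for g
    using that assms(1,3) assms(2)[OF that] by (simp add: G_mult)
  have "tr (r \<otimes> s) = (\<Oplus>g\<in>G. r \<otimes> g s)"
    unfolding tr_def using assms(1,3) G_closed by (intro finsum_cong') (auto simp: *)
  then show ?thesis
    using assms(1,3) G_closed finite_G by (simp add: tr_def finsum_rdistr Pi_def)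
qed

lemma tr_nonzero: obtains x where "x \<in> carrier S" "tr x \<noteq> \<zero>"
proof -
  have "\<exists>x\<in>carrier S. tr x \<noteq> \<zero>"
  proof (rule ccontr)
    assume *: "\<not> (\<exists>x\<in>carrier S. tr x \<noteq> \<zero>)"
    have "\<one> = \<zero>"
    \<comment> \<open>A vanishing trace is a relation with all coefficients 1 among the members of
      \<open>G\<close>, viewed as characters of the multiplicative monoid of \<open>S\<close>. The
      coefficient at the identity automorphism gives the contradiction.\<close>
    proof (rule Dedekind_independence[where M = S and F = G and a = "\<lambda>_. \<one>"])
      show "monoid S" by (rule monoid_axioms)
      show "finite G" by (rule finite_G)
      \<comment> \<open>Extensionality comes from \<open>Bij\<close>: members of \<open>G\<close>
        that agree on \<open>S\<close> are equal, hence distinct members are distinct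
        characters.\<close>
      show "G \<subseteq> hom S S \<inter> extensional (carrier S)"
        by (auto simp: hom_def intro: G_closed G_mult Bij_imp_extensional[OF G_Bij])
      show "(\<lambda>g. \<one>) \<in> G \<rightarrow> carrier S" by simp
      show "\<one>\<^bsub>BijGroup (carrier S)\<^esub> \<in> G" by (rule subgroup.one_closed[OF subgroup_G])
      show "(\<Oplus>h\<in>G. \<one> \<otimes> h x) = \<zero>" if x: "x \<in> carrier S" for x
      proof -
        have "(\<Oplus>h\<in>G. \<one> \<otimes> h x) = tr x"
          unfolding tr_def using G_closed x by (intro finsum_cong') auto
        with * x show ?thesis by simp
      qed
    qed (rule G_one)
    then show False by simp
  qed
  then show thesis using that by blast
qed

section \<open>The cofixed kernel and the trace congruence\<close>

abbreviation N where "N \<equiv> cofixed_kernel S G"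

lemma cofixed_generators_subset:
  "{g s \<ominus> s |g s. g \<in> G \<and> s \<in> carrier S} \<subseteq> carrier S"
  using G_closed by auto

lemma subgroup_cofixed_kernel: "subgroup N (add_monoid S)"
  unfolding cofixed_kernel_def by (rule add.generate_is_subgroup[OF cofixed_generators_subset])

lemma cofixed_kernel_gen: "g \<in> G \<Longrightarrow> s \<in> carrier S \<Longrightarrow> g s \<ominus> s \<in> N"
  unfolding cofixed_kernel_def by (rule generate.incl) blast

lemma cofixed_kernel_finsum:
  assumes "finite I" "\<And>i. i \<in> I \<Longrightarrow> f i \<in> N"
  shows "finsum S f I \<in> N"
  using assms
proof (induction I)
  case empty
  then show ?case using subgroup.one_closed[OF subgroup_cofixed_kernel] by simp
next
  case (insert i I)
  have "f \<in> I \<rightarrow> carrier S" "f i \<in> carrier S"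
    using insert.prems subgroup.mem_carrier[OF subgroup_cofixed_kernel] by auto
  then show ?case
    using insert subgroup.m_closed[OF subgroup_cofixed_kernel] by (simp add: finsum_insert)
qed

lemma cofixed_kernel_tr: "N \<subseteq> kernel (add_monoid S) (add_monoid S) tr"
proof -
  interpret T: group_hom "add_monoid S" "add_monoid S" tr
    by (intro group_hom.intro group_hom_axioms.intro add.is_group tr_hom)
  have "tr (g s \<ominus> s) = \<zero>" if "g \<in> G" "s \<in> carrier S" for g s
    using that T.hom_inv[of s]
    by (simp add: a_minus_def tr_add G_closed tr_G tr_closed r_neg a_inv_def[symmetric])
  then have "{g s \<ominus> s |g s. g \<in> G \<and> s \<in> carrier S} \<subseteq> kernel (add_monoid S) (add_monoid S) tr"
    using G_closed by (auto simp: kernel_def)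
  then show ?thesis
    unfolding cofixed_kernel_def by (rule add.generate_subgroup_incl[OF _ T.subgroup_kernel])
qed

text \<open>For fixed \<open>r\<close>, r (g s - s) = g (r s) - r s is again a generator. So the
  additive span is already a submodule over the fixed subring.\<close>

lemma cofixed_kernel_mult:
  assumes r: "r \<in> carrier S" "\<And>g. g \<in> G \<Longrightarrow> g r = r" and n: "n \<in> N"
  shows "r \<otimes> n \<in> N"
proof -
  have "r \<otimes> (g s \<ominus> s) \<in> N" if "g \<in> G" "s \<in> carrier S" for g s
    using that cofixed_kernel_gen[of g "r \<otimes> s"] r(1) r(2)[of g]
    by (simp add: G_mult G_closed a_minus_def r_distr r_minus)
  then have gen: "r \<otimes> h \<in> N" if "h \<in> {g s \<ominus> s |g s. g \<in> G \<and> s \<in> carrier S}" for h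
    using that by auto
  show ?thesis
    using n[unfolded cofixed_kernel_def]
  proof (induction rule: generate.induct)
    case one
    then show ?case using r subgroup.one_closed[OF subgroup_cofixed_kernel] by simp
  next
    case (incl h)
    then show ?case by (rule gen)
  next
    case (inv h)
    then show ?case
      using r gen[of h] subgroup.m_inv_closed[OF subgroup_cofixed_kernel, of "r \<otimes> h"] cofixed_generators_subset
      by (auto simp: a_inv_def[symmetric] r_minus G_closed)
  next
    case (eng h1 h2)
    then have "h1 \<in> carrier S" "h2 \<in> carrier S"
      using subgroup.mem_carrier[OF subgroup_cofixed_kernel] by (auto simp: cofixed_kernel_def)
    then show ?case
      using r eng subgroup.m_closed[OF subgroup_cofixed_kernel] by (simp add: r_distr)
  qed
qed

text \<open>Modulo \<open>N\<close>, each summand \<open>g x \<otimes> s\<close> of \<open>tr x \<otimes> s\<close> can be replaced by its translate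
  \<open>x \<otimes> g\<^sup>-\<^sup>1 s\<close>.\<close>

lemma tr_mult_cong:
  assumes x: "x \<in> carrier S" and s: "s \<in> carrier S"
  shows "tr x \<otimes> s \<ominus> x \<otimes> tr s \<in> N"
proof -
  define i where "i g = inv\<^bsub>BijGroup (carrier S)\<^esub> g" for g
  have i: "i g \<in> G" "g (i g s) = s" if "g \<in> G" for g
  proof -
    show ig: "i g \<in> G" unfolding i_def using subgroup.m_inv_closed[OF subgroup_G that] .
    have "g (i g s) = \<one>\<^bsub>BijGroup (carrier S)\<^esub> s"
      using mult_BijGroup_apply[OF that ig s] G_in_BijGroup[OF that] by (simp add: i_def)
    then show "g (i g s) = s" using s by (simp add: BijGroup_def)
  qed
  \<comment> \<open>The generator of \<open>N\<close> attached to \<open>x \<otimes> i g s\<close>,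
    an element that \<open>g\<close> sends to \<open>g x \<otimes> s\<close>.\<close>
  define d where "d g = g (x \<otimes> i g s) \<ominus> x \<otimes> i g s" for g
  have d: "d g \<in> N" "d g \<in> carrier S" if "g \<in> G" for g
    using that x s i G_closed cofixed_kernel_gen by (auto simp: d_def)
  have is_closed: "i g s \<in> carrier S" if "g \<in> G" for g
    using G_closed[OF i(1)[OF that] s] .
  have gx: "g x \<otimes> s = d g \<oplus> x \<otimes> i g s" if "g \<in> G" for g
    using that x s is_closed i(2)[OF that] G_closed
    by (simp add: d_def G_mult a_minus_def a_assoc l_neg)
  have "tr x \<otimes> s = (\<Oplus>g\<in>G. g x \<otimes> s)"
    unfolding tr_def using x s finite_G G_closed by (intro finsum_ldistr) auto
  also have "\<dots> = (\<Oplus>g\<in>G. d g \<oplus> x \<otimes> i g s)"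
    using x is_closed d by (intro finsum_cong') (auto simp: gx)
  also have "\<dots> = (\<Oplus>g\<in>G. d g) \<oplus> (\<Oplus>g\<in>G. x \<otimes> i g s)"
    using x is_closed d by (intro finsum_addf) auto
  also have "(\<Oplus>g\<in>G. x \<otimes> i g s) = x \<otimes> tr s"
    using x s is_closed finite_G by (simp add: tr_inverses i_def[symmetric] finsum_rdistr Pi_def)
  finally have "tr x \<otimes> s \<ominus> x \<otimes> tr s = (\<Oplus>g\<in>G. d g)"
    using x s d tr_closed by (simp add: a_minus_def a_assoc r_neg Pi_def)
  then show ?thesis
    using cofixed_kernel_finsum[OF finite_G d(1)] by simp
qed

lemma carrier_fixed_subring: "carrier (fixed_subring S G) = {s \<in> carrier S. \<forall>g\<in>G. g s = s}"
  and fixed_subring_sel [simp]: "mult (fixed_subring S G) = mult S" "add (fixed_subring S G) = add S"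
    "one (fixed_subring S G) = one S" "ring.zero (fixed_subring S G) = ring.zero S"
  by (simp_all add: fixed_subring_def)

lemma domain_fixed_subring: "domain (fixed_subring S G)"
  unfolding fixed_subring_def
proof (intro subring_is_domain subringI)
qed (auto simp: G_closed G_mult G_add G_one G_minus, metis+)

end

theorem proposition5p7:
  fixes S :: "('a, 'm) ring_scheme" and G :: "('a \<Rightarrow> 'a) set"
  assumes "domain S"
    and "subgroup G (BijGroup (carrier S))" and "G \<subseteq> ring_iso S S" and "finite G"
  shows "module_rank (fixed_subring S G) (cofixed_module S G) = 1"
proof -
  interpret finite_automorphism_group S G
    using assms by (intro finite_automorphism_group.intro finite_automorphism_group_axioms.intro)
  interpret R: domain "fixed_subring S G"
    by (rule domain_fixed_subring)
  let ?R = "fixed_subring S G" and ?M = "cofixed_module S G"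
  define coset where "coset s = N #>\<^bsub>add_monoid S\<^esub> s" for s
  \<comment> \<open>Additive cosets in the ring are cosets in \<open>add_monoid S\<close>; in this
    form the record matches \<open>quotient_module\<close>.\<close>
  have cofixed_module_eq: "?M = \<lparr>carrier = rcosets\<^bsub>add_monoid S\<^esub> N, mult = undefined,
      one = undefined, ring.zero = N, add = set_mult (add_monoid S),
      smult = \<lambda>r U. \<Union>x\<in>U. N #>\<^bsub>add_monoid S\<^esub> (r \<otimes>\<^bsub>S\<^esub> x)\<rparr>"
    by (simp add: cofixed_module_def A_RCOSETS_def set_add_def a_r_coset_def)
  note quotient = a_comm_group R.is_cring subgroup_cofixed_kernel
  have hyps: "(\<lambda>x. r \<otimes>\<^bsub>S\<^esub> x) \<in> hom (add_monoid S) (add_monoid S)"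
    "\<And>n. n \<in> N \<Longrightarrow> r \<otimes>\<^bsub>S\<^esub> n \<in> N"
    if "r \<in> carrier ?R" for r
    using that by (auto simp: carrier_fixed_subring r_distr cofixed_kernel_mult intro!: homI)
  have smult: "r \<odot>\<^bsub>?M\<^esub> coset s = coset (r \<otimes>\<^bsub>S\<^esub> s)" if "r \<in> carrier ?R" "s \<in> carrier S" for r s
    unfolding cofixed_module_eq coset_def
    using comm_group.quotient_smult[OF quotient, where \<phi> = "\<lambda>r x. r \<otimes>\<^bsub>S\<^esub> x" and r = r and x = s] that hyps
    by (simp add: carrier_fixed_subring l_distr m_assoc)
  have "module ?R ?M"
    unfolding cofixed_module_eq
    by (rule comm_group.quotient_module[OF quotient, where \<phi> = "\<lambda>r x. r \<otimes>\<^bsub>S\<^esub> x"])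
      (use hyps in \<open>simp_all add: carrier_fixed_subring l_distr m_assoc\<close>)
  have cosetE: "\<exists>s\<in>carrier S. U = coset s" if "U \<in> carrier ?M" for U
    using that by (auto simp: cofixed_module_eq RCOSETS_def coset_def)
  have coset_closed: "coset s \<in> carrier ?M" if "s \<in> carrier S" for s
    using that by (auto simp: cofixed_module_eq RCOSETS_def coset_def)
  have coset_add: "coset s \<oplus>\<^bsub>?M\<^esub> coset s' = coset (s \<oplus>\<^bsub>S\<^esub> s')" if "s \<in> carrier S" "s' \<in> carrier S" for s s'
    using that normal.rcos_sum[OF comm_group.subgroup_imp_normal[OF a_comm_group subgroup_cofixed_kernel]]
    by (simp add: cofixed_module_eq coset_def)
  \<comment> \<open>An arbitrary representative may be chosen: two of them differ by an element of
    \<open>N\<close>, where the trace vanishes.\<close>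
  define t where "t U = tr (SOME s. s \<in> U)" for U
  have t: "t (coset s) = tr s" if s: "s \<in> carrier S" for s
  proof -
    have "s \<in> coset s"
      unfolding coset_def using s add.rcos_self[OF _ subgroup_cofixed_kernel] by simp
    then have "(SOME y. y \<in> coset s) \<in> coset s"
      by (rule someI)
    then obtain n where n: "n \<in> N" "(SOME y. y \<in> coset s) = n \<oplus>\<^bsub>S\<^esub> s"
      by (auto simp: coset_def r_coset_def)
    then have "n \<in> carrier S" "tr n = \<zero>\<^bsub>S\<^esub>"
      using cofixed_kernel_tr by (auto simp: kernel_def)
    with n s show ?thesis
      by (simp add: t_def tr_add tr_closed)
  qed
  have tr_fixed: "tr s \<in> carrier ?R" if "s \<in> carrier S" for s
    using that by (simp add: carrier_fixed_subring tr_closed G_tr)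
  obtain x where x: "x \<in> carrier S" "tr x \<noteq> \<zero>\<^bsub>S\<^esub>"
    by (rule tr_nonzero)
  show ?thesis
  proof (rule module_rank_eq_1[where t = t and x = "coset x"])
    show "domain ?R" by (rule domain_fixed_subring)
    show "module ?R ?M" by fact
    fix U assume "U \<in> carrier ?M"
    then obtain s where s: "s \<in> carrier S" "U = coset s" using cosetE by blast
    then show "t U \<in> carrier ?R"
      by (simp add: t tr_fixed)
    \<comment> \<open>The trace congruence read in the quotient. Both sides are actions of fixed
      elements, \<open>tr x\<close> on the class of \<open>s\<close> and \<open>tr s\<close> on the
      class of \<open>x\<close>, as \<open>tx_smult\<close> requires.\<close>
    have "coset (tr x \<otimes>\<^bsub>S\<^esub> s) = coset (x \<otimes>\<^bsub>S\<^esub> tr s)"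
      unfolding coset_def
      using x s tr_closed tr_mult_cong[OF x(1) s(1)] subgroup_cofixed_kernel
      by (intro add.rcos_eqI) (auto simp: a_minus_def a_inv_def)
    then show "t (coset x) \<odot>\<^bsub>?M\<^esub> U = t U \<odot>\<^bsub>?M\<^esub> coset x"
      using x s by (simp add: t smult tr_fixed tr_closed m_comm)
    show "t (r \<odot>\<^bsub>?M\<^esub> U) = r \<otimes>\<^bsub>?R\<^esub> t U" if "r \<in> carrier ?R" for r
      using that s by (simp add: smult t carrier_fixed_subring tr_mult_fixed)
    fix V assume "V \<in> carrier ?M"
    then obtain s' where "s' \<in> carrier S" "V = coset s'" using cosetE by blast
    with s show "t (U \<oplus>\<^bsub>?M\<^esub> V) = t U \<oplus>\<^bsub>?R\<^esub> t V"
      by (simp add: coset_add t tr_add)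
  qed (use x in \<open>simp_all add: coset_closed t\<close>)
qed

end
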